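(* Let $K$ be a field, $A$ a Noetherian $K$-algebra, $R_A=A[x_1,\dots,x_n]$. Let $\mathcal O$ be a finite order ideal of terms, and consider the border reduction structure $\mathcal J_{\partial\mathcal O,\deg}$ in which the terms of $\partial\mathcal O$ are ordered increasingly by degree. Let $B\subset R_A$ be a $\partial\mathcal O$-marked set. The following are equivalent: (1) $B$ is a $\partial\mathcal O$-marked basis; (2) for every $b,b'\in B$ such that $(\mathrm{Ht}(b),\mathrm{Ht}(b'))$ is a non-multiplicative couple (for $\mathcal J_{\partial\mathcal O,\deg}$), the $S$-polynomial $S(b,b')$ reduces to $0$ by the reduction relation of $B$ with respect to $\mathcal J_{\partial\mathcal O,\deg}$.
   Context: $\mathbb T$ is the set of terms (monic monomials) in $x_1,\dots,x_n$. An order ideal is a (nonempty) set $\mathcal O\subseteq\mathbb T$ closed under taking divisors. For a finite order ideal $\mathcal O$, the border is $\partial\mathcal O=\{x_i\tau:\tau\in\mathcal O,\ 1\le i\le n\}\setminus\mathcal O$. A marked polynomial is a polynomial $f$ with a specified term $\mathrm{Ht}(f)$ of its support (head term) occurring with coefficient $1$. A $\partial\mathcal O$-marked set in $R_A$ is a set $B=\{b_\beta:\beta\in\partial\mathcal O\}$ of exactly $|\partial\mathcal O|$ marked polynomials with $\mathrm{Ht}(b_\beta)=\beta$ and $b_\beta-\beta\in\langle\mathcal O\rangle_A$, where $\langle\mathcal O\rangle_A$ is the $A$-module generated by $\mathcal O$. It is a $\partial\mathcal O$-marked basis if $R_A=(B)\oplus\langle\mathcal O\rangle_A$. Border reduction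 structure $\mathcal J_{\partial\mathcal O,\deg}$: label the border terms $\beta_1,\dots,\beta_m$ so that $\deg\beta_i\le\deg\beta_j$ for $i<j$ (terms of equal degree are ordered arbitrarily). The multiplicative set of $\beta_i$ is $\mathcal T_{\beta_i}=\{\mu\in\mathbb T : \beta_j \text{ does not divide } \beta_i\mu \text{ for all } j>i\}$, and its cone is $\{\mu\beta_i:\mu\in\mathcal T_{\beta_i}\}$. One reduction step of $g\in R_A$ by $B$: choose a term $\gamma$ in the support of $g$, with coefficient $c$, such that $\gamma=\eta\beta_i$ with $\eta\in\mathcal T_{\beta_i}$, and replace $g$ by $g-c\,\eta\, b_{\beta_i}$. A polynomial $g$ reduces to $h$ if $h$ is obtained from $g$ by finitely many (possibly zero) such steps. A couple $(\beta_i,\beta_j)$ of border terms is non-multiplicative if there is a variable $x_\ell\notin\mathcal T_{\beta_i}$ such that $x_\ell\beta_i$ belongs to the cone of $\beta_j$. For marked polynomials $f,f'$, $S(f,f')=\eta f-\eta' f'$, where $\eta,\eta'$ are the terms with $\eta\,\mathrm{Ht}(f)=\eta'\,\mathrm{Ht}(f')=\mathrm{lcm}(\mathrm{Ht}(f),\mathrm{Ht}(f'))$. *)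

theory Defs
  imports Complex_Main "HOL-Library.Poly_Mapping"
begin

text \<open>
  The finite type \<open>'x\<close> indexes the variables. Terms are exponent vectors, so multiplication of
  terms is written additively, and the variable with index \<open>l\<close> is \<open>Poly_Mapping.single l 1\<close>.
  The polynomial ring over \<open>'a\<close> is \<open>('x, 'a) mpol\<close>; the support of \<open>f\<close> is
  \<open>Poly_Mapping.keys f\<close>, and \<open>Poly_Mapping.single t c\<close> is the monomial with term \<open>t\<close> and
  coefficient \<open>c\<close>.
\<close>

type_synonym 'x monic = "'x \<Rightarrow>\<^sub>0 nat"
type_synonym ('x, 'a) mpol = "('x \<Rightarrow>\<^sub>0 nat) \<Rightarrow>\<^sub>0 'a"


subsection \<open>Coefficient rings\<close>

text \<open>Ideals of a commutative ring are its submodules as a module over itself.\<close>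

lemma module_times: "module ((*) :: 'r::comm_ring_1 \<Rightarrow> 'r \<Rightarrow> 'r)"
  by unfold_locales (simp_all add: algebra_simps)

definition noetherian :: "'a::comm_ring_1 itself \<Rightarrow> bool" where
  "noetherian _ \<longleftrightarrow>
     (\<forall>I :: 'a set. module.subspace (*) I \<longrightarrow> (\<exists>F. finite F \<and> I = module.span (*) F))"

locale commutative_algebra = vector_space scale
  for scale :: "'k::field \<Rightarrow> 'a::comm_ring_1 \<Rightarrow> 'a" +
  assumes scale_mult_left: "scale c (a * b) = scale c a * b"


subsection \<open>Terms, order ideals and borders\<close>

definition tdvd :: "'x monic \<Rightarrow> 'x monic \<Rightarrow> bool"  (infix "tdvd" 50) where
  "s tdvd t \<longleftrightarrow> (\<exists>u. t = u + s)"

definition tdeg :: "'x::finite monic \<Rightarrow> nat" where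
  "tdeg t = (\<Sum>x\<in>UNIV. Poly_Mapping.lookup t x)"

definition tlcm :: "'x::finite monic \<Rightarrow> 'x monic \<Rightarrow> 'x monic" where
  "tlcm s t =
     Abs_poly_mapping (\<lambda>x. max (Poly_Mapping.lookup s x) (Poly_Mapping.lookup t x))"

lemma lookup_tlcm [simp]:
  "Poly_Mapping.lookup (tlcm s t) x = max (Poly_Mapping.lookup s x) (Poly_Mapping.lookup t x)"
  unfolding tlcm_def by (subst Abs_poly_mapping_inverse) simp_all

lemma tlcm_minus_left: "tlcm s t - s + s = tlcm s t"
  by (rule poly_mapping_eqI) (simp add: lookup_add lookup_minus)

lemma tlcm_minus_right: "tlcm s t - t + t = tlcm s t"
  by (rule poly_mapping_eqI) (simp add: lookup_add lookup_minus)

lemma tlcm_least: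
  assumes "s tdvd u" "t tdvd u"
  shows "tlcm s t tdvd u"
proof -
  have "u = (u - tlcm s t) + tlcm s t"
    using assms by (auto simp: tdvd_def poly_mapping_eq_iff fun_eq_iff lookup_add lookup_minus)
      (metis add.commute le_add1 le_add_diff_inverse2 max.bounded_iff)
  then show ?thesis
    unfolding tdvd_def by blast
qed

definition order_ideal :: "'x monic set \<Rightarrow> bool" where
  "order_ideal ord \<longleftrightarrow> ord \<noteq> {} \<and> (\<forall>t\<in>ord. \<forall>s. s tdvd t \<longrightarrow> s \<in> ord)"

definition border :: "'x monic set \<Rightarrow> 'x monic set" where
  "border ord = {Poly_Mapping.single l 1 + t | l t. t \<in> ord} - ord"


subsection \<open>Marked sets and marked bases\<close>

definition mpol_scale :: "'a::comm_ring_1 \<Rightarrow> ('x, 'a) mpol \<Rightarrow> ('x, 'a) mpol" where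
  "mpol_scale c f = Poly_Mapping.single 0 c * f"

lemma module_mpol_scale: "module mpol_scale"
  by unfold_locales
    (simp_all add: mpol_scale_def algebra_simps single_add mult_single flip: mult.assoc)

lemma lookup_mpol_scale: "Poly_Mapping.lookup (mpol_scale c f) t = c * Poly_Mapping.lookup f t"
  by (simp add: mpol_scale_def Poly_Mapping.map.rep_eq when_def flip: mult_map_scale_conv_mult)

definition term_span :: "'x monic set \<Rightarrow> ('x, 'a::comm_ring_1) mpol set" where
  "term_span ord = module.span mpol_scale ((\<lambda>t. Poly_Mapping.single t 1) ` ord)"

text \<open>A marked polynomial is a pair of a polynomial and its head term.\<close>

type_synonym ('x, 'a) marked = "('x, 'a) mpol \<times> 'x monic"

abbreviation pol :: "('x, 'a::zero) marked \<Rightarrow> ('x, 'a) mpol" where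
  "pol b \<equiv> fst b"

abbreviation Ht :: "('x, 'a::zero) marked \<Rightarrow> 'x monic" where
  "Ht b \<equiv> snd b"

definition is_marked :: "('x, 'a::comm_ring_1) marked \<Rightarrow> bool" where
  "is_marked b \<longleftrightarrow> Ht b \<in> Poly_Mapping.keys (pol b) \<and> Poly_Mapping.lookup (pol b) (Ht b) = 1"

definition marked_set :: "'x monic set \<Rightarrow> ('x, 'a::comm_ring_1) marked set \<Rightarrow> bool" where
  "marked_set ord B \<longleftrightarrow>
     bij_betw snd B (border ord) \<and>
     (\<forall>b\<in>B. is_marked b \<and> pol b - Poly_Mapping.single (Ht b) 1 \<in> term_span ord)"

definition marked_basis :: "'x monic set \<Rightarrow> ('x, 'a::comm_ring_1) marked set \<Rightarrow> bool" where
  "marked_basis ord B \<longleftrightarrow>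
     {u + v | u v. u \<in> module.span (*) (fst ` B) \<and> v \<in> term_span ord} = UNIV \<and>
     module.span (*) (fst ` B) \<inter> term_span ord = {0}"


subsection \<open>The border reduction structure\<close>

text \<open>
  A labelling of the border is a list \<open>bs\<close>, so labels start at \<open>0\<close>; any order among terms of
  equal degree is admitted.
\<close>

definition border_labelling :: "'x::finite monic set \<Rightarrow> 'x monic list \<Rightarrow> bool" where
  "border_labelling ord bs \<longleftrightarrow>
     distinct bs \<and> set bs = border ord \<and> sorted (map tdeg bs)"

definition mult_terms :: "'x monic list \<Rightarrow> nat \<Rightarrow> 'x monic set" where
  "mult_terms bs i = {m. \<forall>j. i < j \<and> j < length bs \<longrightarrow> \<not> bs ! j tdvd m + bs ! i}"

definition cone :: "'x monic list \<Rightarrow> nat \<Rightarrow> 'x monic set" where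
  "cone bs i = {m + bs ! i | m. m \<in> mult_terms bs i}"

inductive red_step ::
  "'x monic list \<Rightarrow> ('x, 'a::comm_ring_1) marked set \<Rightarrow> ('x, 'a) mpol \<Rightarrow> ('x, 'a) mpol \<Rightarrow> bool"
  for bs B where
  "\<lbrakk>t \<in> Poly_Mapping.keys g; i < length bs; m \<in> mult_terms bs i; t = m + bs ! i;
    b \<in> B; Ht b = bs ! i\<rbrakk>
   \<Longrightarrow> red_step bs B g (g - Poly_Mapping.single m (Poly_Mapping.lookup g t) * pol b)"

definition reduces_to ::
  "'x monic list \<Rightarrow> ('x, 'a::comm_ring_1) marked set \<Rightarrow> ('x, 'a) mpol \<Rightarrow> ('x, 'a) mpol \<Rightarrow> bool"
  where "reduces_to bs B = (red_step bs B)\<^sup>*\<^sup>*"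

definition nonmult_couple :: "'x monic list \<Rightarrow> 'x monic \<Rightarrow> 'x monic \<Rightarrow> bool" where
  "nonmult_couple bs s t \<longleftrightarrow>
     (\<exists>i j l. i < length bs \<and> j < length bs \<and> s = bs ! i \<and> t = bs ! j \<and>
        Poly_Mapping.single l 1 \<notin> mult_terms bs i \<and>
        Poly_Mapping.single l 1 + bs ! i \<in> cone bs j)"

text \<open>The subtractions of exponent vectors are exact, by \<open>tlcm_minus_left\<close> and
  \<open>tlcm_minus_right\<close>.\<close>

definition spoly ::
  "('x::finite, 'a::comm_ring_1) marked \<Rightarrow> ('x, 'a) marked \<Rightarrow> ('x, 'a) mpol" where
  "spoly f f' =
     Poly_Mapping.single (tlcm (Ht f) (Ht f') - Ht f) 1 * pol f -
     Poly_Mapping.single (tlcm (Ht f) (Ht f') - Ht f') 1 * pol f'"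

end

theory Submission
  imports Defs "HOL-Library.Multiset"
begin

text \<open>
  Let \<open>(B)\<close> be the ideal generated by the marked set and \<open>\<langle>O\<rangle>\<close> the span of the order ideal.

  Every polynomial reduces to an element of \<open>\<langle>O\<rangle>\<close> (\<open>reduces_to_term_span\<close>). The reason is the ordering of the border
  by degree: a term \<open>t\<close> outside \<open>O\<close> is rewritten through a border divisor \<open>\<beta>\<close> of the largest
  possible degree, so the cofactor \<open>m\<close> in \<open>t = m \<beta>\<close> has smaller degree than any \<open>v\<close> with
  \<open>t = v s\<close>, \<open>s \<in> O\<close>. The new terms are of the form \<open>m s\<close> with \<open>s \<in> O\<close>, hence they are closer to \<open>O\<close> than
  \<open>t\<close>. As reduction does not change the class modulo \<open>(B)\<close>, every polynomial lies in
  \<open>(B) + \<langle>O\<rangle>\<close>. If moreover the sum is direct, then the elements of \<open>(B)\<close>, among them the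
  S-polynomials, reduce to an element of \<open>(B) \<inter> \<langle>O\<rangle> = 0\<close>.

  For the converse, suppose that the S-polynomials of the non-multiplicative couples reduce to \<open>0\<close>.
  As in Mourrain's criterion, the proof turns \<open>\<langle>O\<rangle>\<close> into a module over the polynomial ring. Rewriting each
  border term once gives a linear map \<open>nf\<close> to \<open>\<langle>O\<rangle>\<close>, and \<open>f \<mapsto> nf (x\<^sub>l f)\<close> is a formal
  multiplication by \<open>x\<^sub>l\<close> on \<open>\<langle>O\<rangle>\<close>. For \<open>s \<in> O\<close>, multiplying by \<open>x\<^sub>l\<close> and then by \<open>x\<^sub>k\<close> gives a result that
  depends only on the product \<open>x\<^sub>k x\<^sub>l s\<close>: if this term is in the cone of \<open>\<beta>\<close>, the
  S-polynomial of \<open>\<beta>\<close> with the border term that occurs on the way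
  is a relation that identifies the result with the one computed from \<open>\<beta>\<close>
  (\<open>mulvar_mulvar_mono\<close>). So the formal multiplications commute (\<open>mulvar_commute\<close>), and applying
  polynomials in them to \<open>1\<close> is a well-defined linear map from the polynomial ring to \<open>\<langle>O\<rangle>\<close>. It is the identity
  on \<open>\<langle>O\<rangle>\<close>, and its kernel is an ideal that contains \<open>B\<close>. Hence \<open>(B) \<inter> \<langle>O\<rangle> = 0\<close>.
\<close>

section \<open>Terms\<close>

abbreviation var :: "'x \<Rightarrow> 'x monic" where
  "var l \<equiv> Poly_Mapping.single l 1"

abbreviation mono :: "'x monic \<Rightarrow> ('x, 'a::comm_ring_1) mpol" where
  "mono t \<equiv> Poly_Mapping.single t 1"

lemma tdeg_add [simp]: "tdeg (s + t) = tdeg s + tdeg t"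
  by (simp add: tdeg_def lookup_add sum.distrib)

lemma tdeg_zero [simp]: "tdeg 0 = 0"
  by (simp add: tdeg_def)

lemma tdeg_single [simp]: "tdeg (Poly_Mapping.single l n) = n"
  by (simp add: tdeg_def lookup_single when_def)

lemma tdeg_eq_0_iff [simp]: "tdeg t = 0 \<longleftrightarrow> t = 0"
  by (auto simp: tdeg_def poly_mapping_eq_iff fun_eq_iff)

lemma term_eq_var_add:
  assumes "t \<noteq> 0"
  obtains l s where "t = var l + s"
proof -
  obtain l where l: "Poly_Mapping.lookup t l \<noteq> 0"
    using assms by (auto simp: poly_mapping_eq_iff fun_eq_iff)
  have "t = var l + (t - var l)"
    using l by (intro poly_mapping_eqI) (auto simp: lookup_add lookup_minus lookup_single when_def)
  then show ?thesis by (rule that)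
qed

lemma term_induct [case_names zero var_add]:
  fixes t :: "'x::finite monic"
  assumes "P 0" and "\<And>l s. P s \<Longrightarrow> P (var l + s)"
  shows "P t"
proof (induction "tdeg t" arbitrary: t)
  case 0
  then show ?case using assms(1) by simp
next
  case (Suc n)
  then have "t \<noteq> 0" by auto
  then obtain l s where t: "t = var l + s" by (rule term_eq_var_add)
  with Suc have "P s" by simp
  then show ?case unfolding t by (rule assms(2))
qed

lemma tdeg_le_1_cases:
  assumes "tdeg t \<le> 1"
  obtains "t = 0" | l where "t = var l"
proof (cases "t = 0")
  case False
  then obtain l s where t: "t = var l + s" by (rule term_eq_var_add)
  with assms have "s = 0" by simp
  with t that show ?thesis by simp
qed (use that in blast)


section \<open>Linear maps on polynomials\<close>

interpretation mpol: module "mpol_scale :: 'a::comm_ring_1 \<Rightarrow> ('x, 'a) mpol \<Rightarrow> ('x, 'a) mpol"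
  by (rule module_mpol_scale)

interpretation mpol2: module_pair
  "mpol_scale :: 'a::comm_ring_1 \<Rightarrow> ('x, 'a) mpol \<Rightarrow> ('x, 'a) mpol"
  "mpol_scale :: 'a::comm_ring_1 \<Rightarrow> ('x, 'a) mpol \<Rightarrow> ('x, 'a) mpol" ..

interpretation ideal: module "(*) :: ('x, 'a::comm_ring_1) mpol \<Rightarrow> ('x, 'a) mpol \<Rightarrow> ('x, 'a) mpol"
  by (rule module_times)

abbreviation mpol_linear ::
  "(('x, 'a::comm_ring_1) mpol \<Rightarrow> ('x, 'a) mpol) \<Rightarrow> bool" where
  "mpol_linear \<equiv> module_hom mpol_scale mpol_scale"

lemma mpol_scale_mono: "mpol_scale c (mono t) = Poly_Mapping.single t c"
  by (simp add: mpol_scale_def mult_single)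

lemma mpol_expand:
  "(f :: ('x, 'a::comm_ring_1) mpol) =
     (\<Sum>t\<in>Poly_Mapping.keys f. mpol_scale (Poly_Mapping.lookup f t) (mono t))"
  by (rule poly_mapping_eqI)
    (simp add: mpol_scale_mono lookup_sum lookup_single when_def sum.delta in_keys_iff)

lemma term_span_eq:
  "(term_span S :: ('x, 'a::comm_ring_1) mpol set) = {f. Poly_Mapping.keys f \<subseteq> S}"
proof (intro set_eqI iffI)
  fix f :: "('x, 'a) mpol"
  assume "f \<in> term_span S"
  then have "f \<in> mpol.span (mono ` S)"
    by (simp add: term_span_def)
  moreover have "mpol.subspace {f :: ('x, 'a) mpol. Poly_Mapping.keys f \<subseteq> S}"
    by (auto simp: mpol.subspace_def lookup_mpol_scale lookup_add in_keys_iff subset_iff)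
       (metis add.right_neutral, metis mult_zero_right)
  moreover have "mono ` S \<subseteq> {f :: ('x, 'a) mpol. Poly_Mapping.keys f \<subseteq> S}"
    by auto
  ultimately show "f \<in> {f. Poly_Mapping.keys f \<subseteq> S}"
    using mpol.span_minimal by blast
next
  fix f :: "('x, 'a) mpol"
  assume "f \<in> {f. Poly_Mapping.keys f \<subseteq> S}"
  then have "(\<Sum>t\<in>Poly_Mapping.keys f. mpol_scale (Poly_Mapping.lookup f t) (mono t)) \<in> term_span S"
    unfolding term_span_def by (intro mpol.span_sum mpol.span_scale mpol.span_base) auto
  then show "f \<in> term_span S"
    by (subst mpol_expand)
qed

lemma mono_in_term_span [simp]: "mono t \<in> term_span S \<longleftrightarrow> t \<in> S"
  by (simp add: term_span_eq)

lemma subspace_term_span: "mpol.subspace (term_span S)"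
  unfolding term_span_def by (rule mpol.subspace_span)

lemma mpol_linear_eq_on_term_span:
  assumes "mpol_linear F" "mpol_linear G" "\<And>t. t \<in> S \<Longrightarrow> F (mono t) = G (mono t)"
    and "f \<in> term_span S"
  shows "F f = G f"
  using mpol2.module_hom_eq_on_span[OF assms(1,2), of "mono ` S" f] assms(3,4)
  by (auto simp: term_span_def)

lemma mpol_linear_eqI:
  assumes "mpol_linear F" "mpol_linear G" "\<And>t. F (mono t) = G (mono t)"
  shows "F f = G f"
  by (rule mpol_linear_eq_on_term_span[OF assms(1,2), of UNIV]) (simp_all add: assms(3) term_span_eq)

lemma mpol_linear_id: "mpol_linear (\<lambda>f. f)"
  by unfold_locales auto

lemma mpol_linear_times: "mpol_linear ((*) g)"
  by unfold_locales (simp_all add: mpol_scale_def distrib_left mult.left_commute)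

lemma mpol_linear_compose:
  assumes "mpol_linear F" "mpol_linear G"
  shows "mpol_linear (\<lambda>f. F (G f))"
  using module_hom_compose[OF assms(2,1)] by (simp add: comp_def)

lemma mono_mult: "mono s * mono t = mono (s + t)"
  by (simp add: mult_single)

lemma mono_times_term_span:
  assumes "f \<in> term_span S" "\<And>s. s \<in> S \<Longrightarrow> t + s \<in> T"
  shows "mono t * f \<in> term_span T"
  using assms keys_mult[of "mono t" f] by (fastforce simp: term_span_eq)

definition lin_ext ::
  "('x monic \<Rightarrow> ('x, 'a::comm_ring_1) mpol) \<Rightarrow> ('x, 'a) mpol \<Rightarrow> ('x, 'a) mpol" where
  "lin_ext F f = (\<Sum>t\<in>Poly_Mapping.keys f. mpol_scale (Poly_Mapping.lookup f t) (F t))"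

lemma lin_ext_superset:
  assumes "finite S" "Poly_Mapping.keys f \<subseteq> S"
  shows "lin_ext F f = (\<Sum>t\<in>S. mpol_scale (Poly_Mapping.lookup f t) (F t))"
  unfolding lin_ext_def using assms
  by (intro sum.mono_neutral_left) (auto simp: in_keys_iff)

lemma mpol_linear_lin_ext:
  fixes F :: "'x monic \<Rightarrow> ('x, 'a::comm_ring_1) mpol"
  shows "mpol_linear (lin_ext F)"
proof unfold_locales
  fix f g :: "('x, 'a) mpol" and c :: 'a
  let ?S = "Poly_Mapping.keys f \<union> Poly_Mapping.keys g"
  show "lin_ext F (f + g) = lin_ext F f + lin_ext F g"
    by (subst (1 2 3) lin_ext_superset[of ?S])
      (use keys_add[of f g] in \<open>auto simp: lookup_add mpol.scale_left_distrib sum.distrib\<close>)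
  have "Poly_Mapping.keys (mpol_scale c f) \<subseteq> Poly_Mapping.keys f"
    by (auto simp: in_keys_iff lookup_mpol_scale)
  then show "lin_ext F (mpol_scale c f) = mpol_scale c (lin_ext F f)"
    by (subst (1 2) lin_ext_superset[of "Poly_Mapping.keys f"])
      (auto simp: lookup_mpol_scale mpol.scale_sum_right)
qed

lemma lin_ext_mono [simp]: "lin_ext F (mono t) = F t"
  by (simp add: lin_ext_def)

lemma lin_ext_in_subspace:
  assumes "mpol.subspace S" "\<And>t. F t \<in> S"
  shows "lin_ext F f \<in> S"
  unfolding lin_ext_def by (intro mpol.subspace_sum mpol.subspace_scale assms)

lemma add_mset_lookup:
  fixes t :: "'x::finite monic"
  shows "Abs_multiset (Poly_Mapping.lookup (var l + t)) =
         add_mset l (Abs_multiset (Poly_Mapping.lookup t))"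
  by (rule multiset_eqI) (simp add: lookup_add lookup_single when_def)

text \<open>
  An action of the free commutative monoid on the variables is given by commuting maps. The
  multiset of the variables of a term, with multiplicities, allows the maps to be composed by a
  fold whose result does not depend on the order.
\<close>

lemma exists_action_of_commuting_maps:
  fixes M :: "'x::finite \<Rightarrow> 'b \<Rightarrow> 'b"
  assumes "\<And>k l v. M k (M l v) = M l (M k v)"
  obtains psi :: "'x monic \<Rightarrow> 'b"
  where "psi 0 = v0" "\<And>l t. psi (var l + t) = M l (psi t)"
proof -
  interpret comp_fun_commute M
    by unfold_locales (simp add: fun_eq_iff assms)
  define psi where "psi t = fold_mset M v0 (Abs_multiset (Poly_Mapping.lookup t))" for t
  have "Abs_multiset (Poly_Mapping.lookup (0 :: 'x monic)) = {#}"
    by (rule multiset_eqI) simp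
  then have "psi 0 = v0"
    by (simp add: psi_def)
  moreover have "psi (var l + t) = M l (psi t)" for l t
    by (simp only: psi_def add_mset_lookup fold_mset_add_mset)
  ultimately show ?thesis by (rule that)
qed

section \<open>Cones and reduction\<close>

locale labelled_marked_set =
  fixes ord :: "'x::finite monic set"
    and bs :: "'x monic list"
    and B :: "('x, 'a::comm_ring_1) marked set"
  assumes ord_ideal: "order_ideal ord"
    and labelling: "border_labelling ord bs"
    and marked: "marked_set ord B"
begin

lemma zero_in_ord: "0 \<in> ord"
  using ord_ideal unfolding order_ideal_def tdvd_def by (metis add.right_neutral equals0I)

lemma add_in_ordD: "s + t \<in> ord \<Longrightarrow> t \<in> ord"
  using ord_ideal unfolding order_ideal_def tdvd_def by blast

lemma set_bs: "set bs = border ord"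
  using labelling by (simp add: border_labelling_def)

lemma nth_bs_border: "i < length bs \<Longrightarrow> bs ! i \<in> border ord"
  using set_bs nth_mem by blast

lemma border_not_ord: "t \<in> border ord \<Longrightarrow> t \<notin> ord"
  by (simp add: border_def)

lemma var_add_border: "s \<in> ord \<Longrightarrow> var l + s \<notin> ord \<Longrightarrow> var l + s \<in> border ord"
  by (auto simp: border_def)

lemma tdeg_bs_mono: "i \<le> j \<Longrightarrow> j < length bs \<Longrightarrow> tdeg (bs ! i) \<le> tdeg (bs ! j)"
  using labelling sorted_nth_mono[of "map tdeg bs" i j] by (simp add: border_labelling_def)

lemma bs_eq_iff: "i < length bs \<Longrightarrow> j < length bs \<Longrightarrow> bs ! i = bs ! j \<longleftrightarrow> i = j"
  using labelling by (simp add: border_labelling_def nth_eq_iff_index_eq)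

lemma obtain_marked:
  assumes "t \<in> border ord"
  obtains b where "b \<in> B" "Ht b = t"
  using marked assms unfolding marked_set_def bij_betw_def by (metis imageE)

lemma marked_unique: "b \<in> B \<Longrightarrow> b' \<in> B \<Longrightarrow> Ht b = Ht b' \<Longrightarrow> b = b'"
  using marked unfolding marked_set_def bij_betw_def by (meson inj_onD)

lemma Ht_border: "b \<in> B \<Longrightarrow> Ht b \<in> border ord"
  using marked unfolding marked_set_def bij_betw_def by blast

lemma tail_in_term_span: "b \<in> B \<Longrightarrow> pol b - mono (Ht b) \<in> term_span ord"
  using marked unfolding marked_set_def by blast

text \<open>
  Among the border divisors of \<open>t\<close>, the one with the largest label has \<open>t\<close> in its cone. By
  the ordering of the labels, its degree is also maximal, so its cofactor has minimal degree.
\<close>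

lemma multiple_of_border_cone:
  assumes "t = v + u" "u \<in> border ord"
  obtains i m where "i < length bs" "m \<in> mult_terms bs i" "t = m + bs ! i" "tdeg m \<le> tdeg v"
proof -
  define I where "I = {i. i < length bs \<and> bs ! i tdvd t}"
  obtain k where k: "k < length bs" "u = bs ! k"
    using assms(2) set_bs by (metis in_set_conv_nth)
  with assms have kI: "k \<in> I" by (auto simp: I_def tdvd_def)
  have fin: "finite I" by (simp add: I_def)
  define i where "i = Max I"
  have "i \<in> I" "k \<le> i" using kI Max_in[OF fin] Max_ge[OF fin kI] unfolding i_def by blast+
  then have i: "i < length bs" and "bs ! i tdvd t" by (auto simp: I_def)
  then obtain m where m: "t = m + bs ! i" by (auto simp: tdvd_def)
  have "m \<in> mult_terms bs i"
  proof -
    have "\<not> bs ! j tdvd t" if "i < j" "j < length bs" for j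
    proof
      assume "bs ! j tdvd t"
      with that have "j \<in> I" by (simp add: I_def)
      with fin have "j \<le> i" by (simp add: i_def)
      with that show False by simp
    qed
    then show ?thesis by (simp add: mult_terms_def m)
  qed
  moreover have "tdeg m \<le> tdeg v"
  proof -
    have "tdeg m + tdeg (bs ! i) = tdeg v + tdeg u"
      using arg_cong[OF assms(1), of tdeg] m by simp
    with tdeg_bs_mono[OF \<open>k \<le> i\<close> i] k show ?thesis by simp
  qed
  ultimately show ?thesis using that i m by blast
qed

text \<open>
  Multiplying \<open>s\<close> by the variables of \<open>v\<close> one by one, the first term outside the order ideal is a border
  term; at least one variable has been used to reach it, which makes the inequality strict.
\<close>

lemma leave_ord_through_border:
  assumes "s \<in> ord" "v + s \<notin> ord"
  shows "\<exists>w u. v + s = w + u \<and> u \<in> border ord \<and> tdeg w < tdeg v"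
  using assms(2)
proof (induction v rule: term_induct)
  case zero
  with assms(1) show ?case by simp
next
  case (var_add l v)
  show ?case
  proof (cases "v + s \<in> ord")
    case True
    then have "var l + (v + s) \<in> border ord"
      using var_add by (intro var_add_border) (simp_all add: add.assoc)
    then have "var l + v + s = 0 + (var l + (v + s)) \<and> var l + (v + s) \<in> border ord \<and>
        tdeg 0 < tdeg (var l + v)"
      by (simp add: add.assoc)
    then show ?thesis by blast
  next
    case False
    with var_add.IH obtain w u where "v + s = w + u" "u \<in> border ord" "tdeg w < tdeg v"
      by blast
    then have "var l + v + s = (var l + w) + u \<and> u \<in> border ord \<and>
        tdeg (var l + w) < tdeg (var l + v)"
      by (simp add: add.assoc)
    then show ?thesis using \<open>u \<in> border ord\<close> by blast
  qed
qed

text \<open>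
  This is the index of a term with respect to an order ideal in the theory of border bases. It is the
  measure that drives every polynomial into the span of the order ideal.
\<close>

definition ord_dist :: "'x monic \<Rightarrow> nat" where
  "ord_dist t = (LEAST n. \<exists>v s. t = v + s \<and> s \<in> ord \<and> n = tdeg v)"

lemma ord_dist_le: "s \<in> ord \<Longrightarrow> ord_dist (v + s) \<le> tdeg v"
  unfolding ord_dist_def by (rule Least_le) blast

lemma ord_dist_witness:
  obtains v s where "t = v + s" "s \<in> ord" "ord_dist t = tdeg v"
proof -
  have "\<exists>v s. t = v + s \<and> s \<in> ord \<and> tdeg t = tdeg v"
    using zero_in_ord by (metis add.right_neutral)
  then have "\<exists>v s. t = v + s \<and> s \<in> ord \<and> ord_dist t = tdeg v"
    unfolding ord_dist_def by (rule LeastI)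
  then show ?thesis using that by blast
qed

lemma ord_dist_eq_0_iff: "ord_dist t = 0 \<longleftrightarrow> t \<in> ord"
  using ord_dist_witness[of t] ord_dist_le[of t 0] by fastforce

text \<open>
  The strict inequality is what lets the distances decrease: the cofactor \<open>m\<close> bounds the distance of all
  terms that replace \<open>t\<close> in a reduction step.
\<close>

lemma obtain_cone:
  assumes "t \<notin> ord"
  obtains i m where "i < length bs" "m \<in> mult_terms bs i" "t = m + bs ! i" "tdeg m < ord_dist t"
proof -
  obtain v s where vs: "t = v + s" "s \<in> ord" "ord_dist t = tdeg v"
    by (rule ord_dist_witness)
  with assms leave_ord_through_border obtain w u
    where "t = w + u" "u \<in> border ord" "tdeg w < tdeg v" by blast
  then show ?thesis using multiple_of_border_cone[of t w u] vs that by (metis order_le_less_trans)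
qed

text \<open>
  A proper border divisor of a border term \<open>\<beta>\<close> has smaller degree, hence a smaller label, so \<open>\<beta>\<close>
  lies only in its own cone.
\<close>

lemma mult_terms_border:
  assumes "i < length bs" "m \<in> mult_terms bs i" "m + bs ! i \<in> border ord"
  shows "m = 0"
proof (rule ccontr)
  assume "m \<noteq> 0"
  then have "tdeg m > 0" using tdeg_eq_0_iff by blast
  obtain j where j: "j < length bs" "m + bs ! i = bs ! j"
    using assms(3) set_bs by (metis in_set_conv_nth)
  then have "tdeg (bs ! i) < tdeg (bs ! j)"
    using \<open>tdeg m > 0\<close> by (metis less_add_same_cancel2 tdeg_add)
  then have "i < j"
    using tdeg_bs_mono[of j i] assms(1) by fastforce
  moreover have "bs ! j tdvd m + bs ! i"
    unfolding j(2) tdvd_def by (metis add.left_neutral)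
  ultimately show False
    using assms(2) j(1) by (auto simp: mult_terms_def)
qed

lemma red_step_diff_in_ideal:
  assumes "red_step bs B g h"
  shows "g - h \<in> ideal.span (fst ` B)"
  using assms
proof cases
  case (1 t i m b)
  then show ?thesis by (auto intro: ideal.span_scale ideal.span_base)
qed

lemma reduces_to_diff_in_ideal:
  assumes "reduces_to bs B g h"
  shows "g - h \<in> ideal.span (fst ` B)"
  using assms unfolding reduces_to_def
proof (induction rule: rtranclp_induct)
  case base
  then show ?case by (simp add: ideal.span_zero)
next
  case (step y z)
  from ideal.span_add[OF step.IH red_step_diff_in_ideal[OF step.hyps(2)]]
  show ?case by simp
qed

lemma red_step_keys:
  assumes "t \<in> Poly_Mapping.keys g" "t \<notin> ord"
  obtains h where "red_step bs B g h"
    "t \<notin> Poly_Mapping.keys h"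
    "\<And>t'. t' \<in> Poly_Mapping.keys h \<Longrightarrow> t' \<in> Poly_Mapping.keys g \<or> ord_dist t' < ord_dist t"
proof -
  obtain i m where i: "i < length bs" "m \<in> mult_terms bs i" "t = m + bs ! i"
    and lt: "tdeg m < ord_dist t"
    by (rule obtain_cone[OF assms(2)])
  obtain b where b: "b \<in> B" "Ht b = bs ! i"
    using obtain_marked[OF nth_bs_border[OF i(1)]] .
  define c where "c = Poly_Mapping.lookup g t"
  define h where "h = g - Poly_Mapping.single m c * pol b"
  define r where "r = mono m * (pol b - mono (Ht b))"
  have h: "h = (g - Poly_Mapping.single t c) - mpol_scale c r"
  proof -
    have "mpol_scale c r = Poly_Mapping.single m c * (pol b - mono (Ht b))"
      by (simp add: r_def mpol_scale_def mult_single flip: mult.assoc)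
    then show ?thesis
      by (simp add: h_def right_diff_distrib mult_single b(2) i(3))
  qed
  have "r \<in> term_span {t'. ord_dist t' < ord_dist t}"
    unfolding r_def using tail_in_term_span[OF b(1)]
    by (rule mono_times_term_span) (use lt ord_dist_le order_le_less_trans in blast)
  then have r: "ord_dist t' < ord_dist t" if "t' \<in> Poly_Mapping.keys r" for t'
    using that by (auto simp: term_span_eq)
  show ?thesis
  proof (rule that[of h])
    show "red_step bs B g h"
      unfolding h_def c_def by (rule red_step.intros) (use assms i b in auto)
    show "t \<notin> Poly_Mapping.keys h"
    proof -
      have "Poly_Mapping.lookup r t = 0" using r[of t] by (auto simp: in_keys_iff)
      then show ?thesis by (simp add: h c_def lookup_minus lookup_mpol_scale in_keys_iff)
    qed
    show "t' \<in> Poly_Mapping.keys g \<or> ord_dist t' < ord_dist t" if "t' \<in> Poly_Mapping.keys h" for t'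
    proof (cases "t' \<in> Poly_Mapping.keys r")
      case False
      then have "Poly_Mapping.lookup r t' = 0" by (simp add: in_keys_iff)
      with that \<open>t \<in> Poly_Mapping.keys g\<close> have "t' \<in> Poly_Mapping.keys g"
        by (auto simp: h in_keys_iff lookup_minus lookup_mpol_scale lookup_single when_def
            split: if_splits)
      then show ?thesis ..
    qed (use r in blast)
  qed
qed

text \<open>
  Each step removes one term at distance \<open>n + 1\<close> and creates terms at distance at most \<open>n\<close> only, so
  the number of terms at distance \<open>n + 1\<close> decreases.
\<close>

lemma reduces_to_lower_dist:
  assumes "\<And>t. t \<in> Poly_Mapping.keys g \<Longrightarrow> ord_dist t \<le> Suc n"
  shows "\<exists>h. reduces_to bs B g h \<and> (\<forall>t\<in>Poly_Mapping.keys h. ord_dist t \<le> n)"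
  using assms
proof (induction "card {t \<in> Poly_Mapping.keys g. ord_dist t = Suc n}" arbitrary: g rule: less_induct)
  case less
  show ?case
  proof (cases "\<exists>t\<in>Poly_Mapping.keys g. ord_dist t = Suc n")
    case False
    then show ?thesis
      using less.prems by (intro exI[of _ g]) (fastforce simp: reduces_to_def le_Suc_eq)
  next
    case True
    then obtain t where t: "t \<in> Poly_Mapping.keys g" "ord_dist t = Suc n" by blast
    then have "t \<notin> ord" using ord_dist_eq_0_iff[of t] by simp
    with t(1) obtain h where h: "red_step bs B g h" "t \<notin> Poly_Mapping.keys h"
      "\<And>t'. t' \<in> Poly_Mapping.keys h \<Longrightarrow> t' \<in> Poly_Mapping.keys g \<or> ord_dist t' < ord_dist t"
      by (rule red_step_keys) blast
    have "card {t \<in> Poly_Mapping.keys h. ord_dist t = Suc n} <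
          card {t \<in> Poly_Mapping.keys g. ord_dist t = Suc n}"
      by (rule psubset_card_mono) (use h t in fastforce)+
    moreover have "ord_dist t' \<le> Suc n" if "t' \<in> Poly_Mapping.keys h" for t'
      using h(3)[OF that] less.prems t(2) by fastforce
    ultimately obtain h' where "reduces_to bs B h h'"
      "\<forall>t\<in>Poly_Mapping.keys h'. ord_dist t \<le> n"
      using less.hyps by blast
    with h(1) show ?thesis
      unfolding reduces_to_def by (meson converse_rtranclp_into_rtranclp)
  qed
qed

lemma reduces_to_term_span: "\<exists>h. reduces_to bs B g h \<and> h \<in> term_span ord"
proof -
  have "\<exists>h. reduces_to bs B g h \<and> h \<in> term_span ord"
    if "\<forall>t\<in>Poly_Mapping.keys g. ord_dist t \<le> n" for n g
    using that
  proof (induction n arbitrary: g)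
    case 0
    then show ?case
      by (intro exI[of _ g]) (auto simp: reduces_to_def term_span_eq ord_dist_eq_0_iff)
  next
    case (Suc n)
    then obtain g' where "reduces_to bs B g g'" "\<forall>t\<in>Poly_Mapping.keys g'. ord_dist t \<le> n"
      using reduces_to_lower_dist[of g n] by blast
    with Suc.IH show ?case
      unfolding reduces_to_def by (meson rtranclp_trans)
  qed
  moreover have "\<forall>t\<in>Poly_Mapping.keys g. ord_dist t \<le> Max (ord_dist ` Poly_Mapping.keys g)"
    by simp
  ultimately show ?thesis by blast
qed

lemma ideal_add_term_span_eq_UNIV:
  "{u + v | u v. u \<in> ideal.span (fst ` B) \<and> v \<in> term_span ord} = UNIV"
proof -
  have "\<exists>u v. g = u + v \<and> u \<in> ideal.span (fst ` B) \<and> v \<in> term_span ord" for g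
  proof -
    obtain h where "reduces_to bs B g h" "h \<in> term_span ord"
      using reduces_to_term_span by blast
    then have "g = (g - h) + h \<and> g - h \<in> ideal.span (fst ` B) \<and> h \<in> term_span ord"
      using reduces_to_diff_in_ideal by simp
    then show ?thesis by blast
  qed
  then show ?thesis by auto
qed

lemma spoly_in_ideal: "b \<in> B \<Longrightarrow> b' \<in> B \<Longrightarrow> spoly b b' \<in> ideal.span (fst ` B)"
  unfolding spoly_def by (intro ideal.span_diff ideal.span_scale ideal.span_base) auto

lemma reduces_to_zero_of_marked_basis:
  assumes "marked_basis ord B" "g \<in> ideal.span (fst ` B)"
  shows "reduces_to bs B g 0"
proof -
  obtain h where h: "reduces_to bs B g h" "h \<in> term_span ord"
    using reduces_to_term_span by blast
  have "g - (g - h) \<in> ideal.span (fst ` B)"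
    using assms(2) reduces_to_diff_in_ideal[OF h(1)] by (rule ideal.span_diff)
  with h(2) assms(1) have "h = 0" by (auto simp: marked_basis_def)
  with h(1) show ?thesis by simp
qed


section \<open>Formal multiplication on the span of the order ideal\<close>

text \<open>
  A border term is replaced by minus the tail of its marked polynomial. The value \<open>0\<close> on terms outside
  the order ideal and its border makes the map total and linear. Any value in the span would do: in
  comparing the two orders of formal multiplication, such a term contributes the same to both.
\<close>

definition nf :: "('x, 'a) mpol \<Rightarrow> ('x, 'a) mpol" where
  "nf = lin_ext (\<lambda>t. if t \<in> ord then mono t
          else if t \<in> border ord then mono t - pol (inv_into B snd t) else 0)"

lemma linear_nf: "mpol_linear nf"
  unfolding nf_def by (rule mpol_linear_lin_ext)

lemmas nf_diff = module_hom.diff[OF linear_nf]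
lemmas nf_add = module_hom.add[OF linear_nf]

lemma nf_zero: "nf 0 = 0"
  by (rule module_hom.zero[OF linear_nf])

lemma nf_mono_ord: "t \<in> ord \<Longrightarrow> nf (mono t) = mono t"
  by (simp add: nf_def)

lemma nf_mono_Ht:
  assumes "b \<in> B"
  shows "nf (mono (Ht b)) = mono (Ht b) - pol b"
proof -
  have "inv_into B snd (Ht b) = b"
    using marked assms by (simp add: marked_set_def bij_betw_def)
  then show ?thesis
    using Ht_border[OF assms] border_not_ord by (simp add: nf_def)
qed

lemma nf_in_term_span: "nf f \<in> term_span ord"
  unfolding nf_def
proof (rule lin_ext_in_subspace[OF subspace_term_span])
  fix t
  show "(if t \<in> ord then mono t
          else if t \<in> border ord then mono t - pol (inv_into B snd t) else 0) \<in> term_span ord"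
  proof (cases "t \<in> border ord")
    case True
    then obtain b where b: "b \<in> B" "Ht b = t" by (rule obtain_marked)
    then have "inv_into B snd t = b"
      using marked by (auto simp: marked_set_def bij_betw_def)
    moreover have "mono t - pol b \<in> term_span ord"
      using mpol.subspace_neg[OF subspace_term_span tail_in_term_span[OF b(1)]] b(2) by simp
    ultimately show ?thesis using True border_not_ord by simp
  qed (simp add: mpol.subspace_0[OF subspace_term_span])
qed

lemma nf_term_span: "f \<in> term_span ord \<Longrightarrow> nf f = f"
  by (rule mpol_linear_eq_on_term_span[OF linear_nf mpol_linear_id nf_mono_ord])

lemma nf_pol:
  assumes "b \<in> B"
  shows "nf (pol b) = 0"
proof -
  have "nf (pol b) = nf (mono (Ht b)) + nf (pol b - mono (Ht b))"
    by (simp flip: nf_add)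
  then show ?thesis
    by (simp add: nf_mono_Ht[OF assms] nf_term_span[OF tail_in_term_span[OF assms]])
qed

text \<open>
  On polynomials supported on the order ideal and its border, a reduction step can only subtract a
  multiple of some \<open>b \<in> B\<close> by a constant, and \<open>nf b = 0\<close>.
\<close>

lemma red_step_near_ord:
  assumes "red_step bs B g h" "g \<in> term_span (ord \<union> border ord)"
  shows "h \<in> term_span (ord \<union> border ord) \<and> nf h = nf g"
  using assms(1)
proof cases
  case (1 t i m b)
  have "t \<in> ord \<union> border ord"
    using assms(2) 1(2) by (auto simp: term_span_eq)
  moreover have "t \<notin> ord"
    using 1 add_in_ordD nth_bs_border border_not_ord by blast
  ultimately have "m = 0"
    using 1 mult_terms_border by blast
  then have h: "h = g - mpol_scale (Poly_Mapping.lookup g t) (pol b)"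
    using 1 by (simp add: mpol_scale_def)
  have "pol b - mono (Ht b) \<in> term_span (ord \<union> border ord)"
    using tail_in_term_span[OF 1(6)] by (auto simp: term_span_eq)
  from mpol.subspace_add[OF subspace_term_span this, of "mono (Ht b)"]
  have "pol b \<in> term_span (ord \<union> border ord)"
    using Ht_border[OF 1(6)] by simp
  then show ?thesis
    unfolding h using assms(2)
    by (simp add: nf_diff module_hom.scale[OF linear_nf] nf_pol[OF 1(6)]
        mpol.subspace_diff mpol.subspace_scale subspace_term_span)
qed

lemma nf_eq_of_reduces_to:
  assumes "reduces_to bs B g h" "g \<in> term_span (ord \<union> border ord)"
  shows "nf h = nf g"
proof -
  have "h \<in> term_span (ord \<union> border ord) \<and> nf h = nf g"
    using assms(1) unfolding reduces_to_def
    by (induction rule: rtranclp_induct) (use assms(2) red_step_near_ord in auto)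
  then show ?thesis by blast
qed

text \<open>
  If the least common multiple were a proper divisor of \<open>x\<^sub>k \<beta>\<^sub>j\<close>, its degree would be at most that
  of \<open>\<beta>\<^sub>j\<close>, hence at most that of \<open>\<beta>\<^sub>i\<close>, and it would equal both of them.
\<close>

lemma tlcm_neighbours:
  assumes "i < length bs" "j < length bs" "j < i" "var k + bs ! j = m + bs ! i"
  shows "tlcm (bs ! j) (bs ! i) = var k + bs ! j"
proof -
  let ?u = "var k + bs ! j" and ?c = "tlcm (bs ! j) (bs ! i)"
  have "?c tdvd ?u"
    using assms(4) by (intro tlcm_least) (unfold tdvd_def, blast+)
  then obtain v where v: "?u = v + ?c" by (auto simp: tdvd_def)
  have "v = 0"
  proof (rule ccontr)
    assume "v \<noteq> 0"
    then have "tdeg v \<ge> 1" using tdeg_eq_0_iff[of v] by linarith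
    then have le: "tdeg ?c \<le> tdeg (bs ! j)"
      using arg_cong[OF v, of tdeg] by simp
    moreover have "tdeg (bs ! j) \<le> tdeg (bs ! i)"
      using tdeg_bs_mono assms by simp
    ultimately have "tdeg (?c - bs ! j) = 0" "tdeg (?c - bs ! i) = 0"
      using arg_cong[OF tlcm_minus_left[of "bs ! j" "bs ! i"], of tdeg]
        arg_cong[OF tlcm_minus_right[of "bs ! j" "bs ! i"], of tdeg]
      unfolding tdeg_add by linarith+
    then have "?c = bs ! j" "?c = bs ! i"
      using tlcm_minus_left[of "bs ! j" "bs ! i"] tlcm_minus_right[of "bs ! j" "bs ! i"]
      by simp_all
    with assms bs_eq_iff[of i j] show False by simp
  qed
  with v show ?thesis by simp
qed

lemma mono_times_pol:
  "b \<in> B \<Longrightarrow> mono m * pol b = mono (m + Ht b) + mono m * (pol b - mono (Ht b))"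
  by (simp add: right_diff_distrib mult_single)

text \<open>
  The hypothesis on S-polynomials enters here. If \<open>x\<^sub>k Ht b'\<close> lies in the cone of another
  head term \<open>Ht b\<close>, the couple is non-multiplicative and the two sides differ by \<open>nf\<close> of its
  S-polynomial. The cofactor \<open>m\<close> has degree at most \<open>1\<close> by the ordering of the labels, so once the
  head terms have cancelled, the S-polynomial is supported on the order ideal and its border, where
  reduction preserves \<open>nf\<close>.
\<close>

lemma nf_neighbours:
  assumes spolys: "\<forall>b\<in>B. \<forall>b'\<in>B. nonmult_couple bs (Ht b) (Ht b') \<longrightarrow>
       reduces_to bs B (spoly b b') 0"
    and i: "i < length bs" "m \<in> mult_terms bs i" "b \<in> B" "Ht b = bs ! i"
    and b': "b' \<in> B" "var k + Ht b' = m + Ht b"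
  shows "nf (mono (var k) * pol b') = nf (mono m * pol b)"
proof -
  obtain j where j: "j < length bs" "Ht b' = bs ! j"
    using Ht_border[OF b'(1)] set_bs by (metis in_set_conv_nth)
  have eq: "var k + bs ! j = m + bs ! i" using b' i j by simp
  (* otherwise bs ! j, which divides m + bs ! i, would exclude m from the multiplicative set *)
  have "\<not> i < j"
    using i(2) j(1) eq by (auto simp: mult_terms_def tdvd_def) (metis)
  show ?thesis
  proof (cases "j = i")
    case True
    then have "m = var k" using eq by simp
    moreover have "b' = b" using marked_unique[OF b'(1) i(3)] True i j by simp
    ultimately show ?thesis by simp
  next
    case False
    with \<open>\<not> i < j\<close> have ji: "j < i" by simp
    have "var k \<notin> mult_terms bs j"
      using ji i(1) eq by (auto simp: mult_terms_def tdvd_def)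
    moreover have "var k + bs ! j \<in> cone bs i"
      unfolding cone_def eq using i(2) by blast
    ultimately have "nonmult_couple bs (Ht b') (Ht b)"
      unfolding nonmult_couple_def using i j by metis
    then have red: "reduces_to bs B (spoly b' b) 0"
      using spolys b' i by blast
    have sp: "spoly b' b = mono (var k) * pol b' - mono m * pol b"
    proof -
      have "tlcm (Ht b') (Ht b) = var k + bs ! j"
        using tlcm_neighbours[OF i(1) j(1) ji eq] i j by simp
      then have "tlcm (Ht b') (Ht b) - Ht b' = var k" "tlcm (Ht b') (Ht b) - Ht b = m"
        unfolding i(4) j(2) by (simp, simp only: eq add_diff_cancel_right')
      then show ?thesis by (simp add: spoly_def)
    qed
    have "tdeg m \<le> 1"
      using arg_cong[OF eq, of tdeg] tdeg_bs_mono[of j i] ji i(1) by simp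
    then have m_ord: "m + s \<in> ord \<union> border ord" if "s \<in> ord" for s
      by (rule tdeg_le_1_cases) (use that var_add_border in auto)
    have k_ord: "var k + s \<in> ord \<union> border ord" if "s \<in> ord" for s
      using that var_add_border by auto
    have "spoly b' b = mono (var k) * (pol b' - mono (Ht b')) - mono m * (pol b - mono (Ht b))"
      unfolding sp mono_times_pol[OF b'(1)] mono_times_pol[OF i(3)] b'(2) by simp
    moreover have "mono (var k) * (pol b' - mono (Ht b')) \<in> term_span (ord \<union> border ord)"
      by (rule mono_times_term_span[OF tail_in_term_span[OF b'(1)] k_ord])
    moreover have "mono m * (pol b - mono (Ht b)) \<in> term_span (ord \<union> border ord)"
      by (rule mono_times_term_span[OF tail_in_term_span[OF i(3)] m_ord])
    ultimately have "spoly b' b \<in> term_span (ord \<union> border ord)"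
      by (simp only: mpol.subspace_diff[OF subspace_term_span])
    from nf_eq_of_reduces_to[OF red this] have "nf (spoly b' b) = 0"
      by (simp only: nf_zero)
    then show ?thesis by (simp only: sp nf_diff right_minus_eq)
  qed
qed

text \<open>
  The inner \<open>nf\<close> is the identity on the span of the order ideal. It makes the map factor through that
  span, so that commutation on the span extends to all polynomials.
\<close>

definition mulvar :: "'x \<Rightarrow> ('x, 'a) mpol \<Rightarrow> ('x, 'a) mpol" where
  "mulvar l f = nf (mono (var l) * nf f)"

lemma linear_mulvar: "mpol_linear (mulvar l)"
  unfolding mulvar_def
  by (rule mpol_linear_compose[OF linear_nf mpol_linear_compose[OF mpol_linear_times linear_nf]])

lemma mulvar_mono: "s \<in> ord \<Longrightarrow> mulvar l (mono s) = nf (mono (var l + s))"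
  by (simp add: mulvar_def nf_mono_ord mono_mult)

text \<open>
  The right-hand side depends on \<open>k\<close>, \<open>l\<close> and \<open>s\<close> only through the product \<open>x\<^sub>k x\<^sub>l s\<close>, which is symmetric
  in \<open>k\<close> and \<open>l\<close>. If \<open>x\<^sub>l s\<close> is in the order ideal, the product is itself a border term, and the
  correction \<open>nf (m b) = nf b\<close> vanishes. Otherwise \<open>x\<^sub>l s\<close> is the head term of some \<open>b'\<close>, the correction
  that arises is \<open>nf (x\<^sub>k b')\<close>, and it is exchanged for \<open>nf (m b)\<close> by the relation between neighbours.
\<close>

lemma mulvar_mulvar_mono:
  assumes spolys: "\<forall>b\<in>B. \<forall>b'\<in>B. nonmult_couple bs (Ht b) (Ht b') \<longrightarrow>
       reduces_to bs B (spoly b b') 0"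
    and i: "i < length bs" "m \<in> mult_terms bs i" "b \<in> B" "Ht b = bs ! i"
    and s: "s \<in> ord" "var k + (var l + s) = m + Ht b"
  shows "mulvar k (mulvar l (mono s)) = nf (mono (m + Ht b)) - nf (mono m * pol b)"
proof (cases "var l + s \<in> ord")
  case True
  have "m + bs ! i \<notin> ord"
    using add_in_ordD nth_bs_border[OF i(1)] border_not_ord by blast
  then have "m + bs ! i \<in> border ord"
    using var_add_border[OF True, of k] s(2) i(4) by simp
  then have "m = 0" using mult_terms_border i by blast
  then have "nf (mono m * pol b) = 0" using nf_pol[OF i(3)] by simp
  then show ?thesis
    using True s by (simp add: mulvar_mono nf_mono_ord)
next
  case False
  then have "var l + s \<in> border ord" using s(1) var_add_border by blast
  then obtain b' where b': "b' \<in> B" "Ht b' = var l + s" by (rule obtain_marked)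
  have "mulvar k (mulvar l (mono s)) = nf (mono (var k) * nf (mono (Ht b')))"
    unfolding mulvar_mono[OF s(1)] b'(2) by (simp add: mulvar_def nf_term_span[OF nf_in_term_span])
  also have "\<dots> = nf (mono (var k) * (mono (Ht b') - pol b'))"
    by (simp add: nf_mono_Ht[OF b'(1)])
  also have "\<dots> = nf (mono (m + Ht b)) - nf (mono (var k) * pol b')"
    using s(2) b'(2) by (simp add: right_diff_distrib mono_mult nf_diff)
  finally show ?thesis
    using nf_neighbours[OF spolys i b'(1)] b'(2) s(2) by simp
qed

lemma mulvar_commute:
  assumes spolys: "\<forall>b\<in>B. \<forall>b'\<in>B. nonmult_couple bs (Ht b) (Ht b') \<longrightarrow>
       reduces_to bs B (spoly b b') 0"
  shows "mulvar k (mulvar l f) = mulvar l (mulvar k f)"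
proof -
  have "mulvar k (mulvar l (mono s)) = mulvar l (mulvar k (mono s))" if s: "s \<in> ord" for s
  proof (cases "var k + (var l + s) \<in> ord")
    case True
    moreover have "var l + (var k + s) = var k + (var l + s)"
      by (simp add: ac_simps)
    ultimately show ?thesis
      using s add_in_ordD[of "var k" "var l + s"] add_in_ordD[of "var l" "var k + s"]
      by (simp add: mulvar_mono nf_mono_ord)
  next
    case False
    then obtain i m where i: "i < length bs" "m \<in> mult_terms bs i"
      "var k + (var l + s) = m + bs ! i" by (rule obtain_cone)
    obtain b where b: "b \<in> B" "Ht b = bs ! i"
      using obtain_marked[OF nth_bs_border[OF i(1)]] .
    have "var l + (var k + s) = m + bs ! i"
      using i(3) by (simp add: ac_simps)
    then show ?thesis
      using mulvar_mulvar_mono[OF spolys i(1,2) b s] i(3) b by simp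
  qed
  then have "mulvar k (mulvar l (nf f)) = mulvar l (mulvar k (nf f))"
    by (rule mpol_linear_eq_on_term_span[OF mpol_linear_compose[OF linear_mulvar linear_mulvar]
          mpol_linear_compose[OF linear_mulvar linear_mulvar] _ nf_in_term_span])
  then show ?thesis
    by (simp add: mulvar_def nf_term_span[OF nf_in_term_span])
qed

lemma marked_basis_of_spolys:
  assumes spolys: "\<forall>b\<in>B. \<forall>b'\<in>B. nonmult_couple bs (Ht b) (Ht b') \<longrightarrow>
       reduces_to bs B (spoly b b') 0"
  shows "marked_basis ord B"
proof -
  obtain psi where psi: "psi 0 = mono 0" "\<And>l t. psi (var l + t) = mulvar l (psi t)"
    by (rule exists_action_of_commuting_maps[of mulvar "mono 0", OF mulvar_commute[OF spolys]])
      (rule that)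
  \<comment> \<open>\<open>phi f\<close> is \<open>f\<close>, with the formal multiplications in place of the variables, applied to \<open>1\<close>.\<close>
  define phi where "phi = lin_ext psi"
  have phi: "mpol_linear phi" unfolding phi_def by (rule mpol_linear_lin_ext)
  have phi_mono: "phi (mono t) = psi t" for t by (simp add: phi_def)
  have psi_ord: "psi s = mono s" if "s \<in> ord" for s
    using that
  proof (induction s rule: term_induct)
    case (var_add l s)
    then show ?case
      using add_in_ordD[of "var l" s] by (simp only: psi mulvar_mono nf_mono_ord)
  qed (simp add: psi)
  have phi_id: "phi f = f" if "f \<in> term_span ord" for f
    by (rule mpol_linear_eq_on_term_span[OF phi mpol_linear_id _ that]) (simp add: phi_mono psi_ord)
  have phi_pol: "phi (pol b) = 0" if b: "b \<in> B" for b
  proof -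
    obtain l s where s: "s \<in> ord" "Ht b = var l + s"
      using Ht_border[OF b] by (auto simp: border_def)
    have "phi (mono (Ht b)) = nf (mono (Ht b))"
      by (simp only: s(2) phi_mono psi psi_ord[OF s(1)] mulvar_mono[OF s(1)])
    then have "phi (mono (Ht b)) = mono (Ht b) - pol b"
      by (simp only: nf_mono_Ht[OF b])
    moreover have "phi (pol b - mono (Ht b)) = pol b - mono (Ht b)"
      by (rule phi_id[OF tail_in_term_span[OF b]])
    moreover have "phi (pol b) = phi (mono (Ht b)) + phi (pol b - mono (Ht b))"
      by (simp flip: module_hom.add[OF phi])
    ultimately show ?thesis by simp
  qed
  \<comment> \<open>\<open>phi\<close> intertwines the two multiplications, so its kernel is an ideal.\<close>
  have phi_var: "phi (mono (var l) * f) = mulvar l (phi f)" for l f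
    by (rule mpol_linear_eqI[OF mpol_linear_compose[OF phi mpol_linear_times]
          mpol_linear_compose[OF linear_mulvar phi]]) (simp only: mono_mult phi_mono psi)
  have phi_mono_times: "phi (mono t * f) = 0" if "phi f = 0" for t f
  proof (induction t rule: term_induct)
    case zero
    then show ?case using that by simp
  next
    case (var_add l t)
    have "phi (mono (var l + t) * f) = mulvar l (phi (mono t * f))"
      by (simp only: phi_var[symmetric] mono_mult[symmetric] mult.assoc)
    then show ?case by (simp only: var_add.IH module_hom.zero[OF linear_mulvar])
  qed
  have phi_times: "phi (g * f) = 0" if "phi f = 0" for g f
    using mpol_linear_eqI[OF mpol_linear_compose[OF phi mpol_linear_times[of f]]
        mpol2.module_hom_zero, of g] phi_mono_times[OF that]
    by (simp add: mult.commute)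
  have "ideal.subspace {f. phi f = 0}"
    by (simp add: ideal.subspace_def module_hom.zero[OF phi] module_hom.add[OF phi] phi_times)
  moreover have "fst ` B \<subseteq> {f. phi f = 0}"
    using phi_pol by auto
  ultimately have ker: "ideal.span (fst ` B) \<subseteq> {f. phi f = 0}"
    by (intro ideal.span_minimal)
  have "ideal.span (fst ` B) \<inter> term_span ord = {0}"
  proof (intro equalityI subsetI)
    fix f
    assume "f \<in> ideal.span (fst ` B) \<inter> term_span ord"
    then have "phi f = 0" "phi f = f" using ker phi_id by auto
    then show "f \<in> {0}" by simp
  qed (simp add: ideal.span_zero mpol.subspace_0[OF subspace_term_span])
  then show ?thesis
    unfolding marked_basis_def using ideal_add_term_span_eq_UNIV by blast
qed

end

theorem proposition2p12:
  fixes scale :: "'k::field \<Rightarrow> 'a::comm_ring_1 \<Rightarrow> 'a"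
    and ord :: "('x::finite \<Rightarrow>\<^sub>0 nat) set"
    and bs :: "('x \<Rightarrow>\<^sub>0 nat) list"
    and B :: "((('x \<Rightarrow>\<^sub>0 nat) \<Rightarrow>\<^sub>0 'a) \<times> ('x \<Rightarrow>\<^sub>0 nat)) set"
  assumes "commutative_algebra scale"
    and "noetherian TYPE('a)"
    and "finite ord" and "order_ideal ord"
    and "border_labelling ord bs"
    and "marked_set ord B"
  shows "marked_basis ord B \<longleftrightarrow>
    (\<forall>b\<in>B. \<forall>b'\<in>B. nonmult_couple bs (Ht b) (Ht b') \<longrightarrow>
       reduces_to bs B (spoly b b') 0)"
proof -
  interpret labelled_marked_set ord bs B
    using assms by unfold_locales
  show ?thesis
    using reduces_to_zero_of_marked_basis spoly_in_ideal marked_basis_of_spolys by blast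
qed

end
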